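(* Let $(A,\cdot,[\cdot,\cdot],\varepsilon,\alpha)$ be a Hom-Gelfand-Dorfman color Hom-algebra and let $(l,r,\rho,\beta,V)$ be a representation of it. On the direct sum of $\Gamma$-graded linear spaces $A\oplus V=\bigoplus_{\gamma\in\Gamma}(A_\gamma\oplus V_\gamma)$ define, for $x_1+v_1\in A_{\gamma_1}\oplus V_{\gamma_1}$ and $x_2+v_2\in A_{\gamma_2}\oplus V_{\gamma_2}$ (and extend bilinearly), $$(x_1+v_1)\cdot'(x_2+v_2)=x_1\cdot x_2+l(x_1)v_2+r(x_2)v_1,$$ $$[x_1+v_1,x_2+v_2]'=[x_1,x_2]+\rho(x_1)v_2-\varepsilon(\gamma_1,\gamma_2)\rho(x_2)v_1,$$ and $(\alpha+\beta)(x_1+v_1)=\alpha(x_1)+\beta(v_1)$. Then $(A\oplus V,\cdot',[\cdot,\cdot]',\varepsilon,\alpha+\beta)$ is a Hom-Gelfand-Dorfman color Hom-algebra.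
   Context: $\mathbb K$ is an algebraically closed field of characteristic $0$; all spaces are over $\mathbb K$. $\Gamma$ is an abelian group and $\varepsilon:\Gamma\times\Gamma\to\mathbb K^*=\mathbb K\setminus\{0\}$ is a commutation factor: $\varepsilon(a,b)\varepsilon(b,a)=1$, $\varepsilon(a,b+c)=\varepsilon(a,b)\varepsilon(a,c)$, $\varepsilon(a+b,c)=\varepsilon(a,c)\varepsilon(b,c)$. For a $\Gamma$-graded linear space $V$, $\mathcal H(V)$ is the set of homogeneous elements; inside $\varepsilon$ a homogeneous element stands for its degree (so $\varepsilon(x+v,y)=\varepsilon(\deg x+\deg v,\deg y)$). A linear map is even if it preserves degrees; a bilinear multiplication on $A$ is even if $A_\gamma A_{\gamma'}\subseteq A_{\gamma+\gamma'}$; a linear map $l:A\to\mathrm{End}(V)$ is even if $l(A_\gamma)V_{\gamma'}\subseteq V_{\gamma+\gamma'}$. A color Hom-algebra $(A,\cdot,\varepsilon,\alpha)$ is a $\Gamma$-graded space $A$ with an even bilinear multiplication $\cdot$ and an even linear map $\alpha:A\to A$ (not assumed multiplicative). All identities are for all $x,y,z\in\mathcal H(A)$, $v\in\mathcal H(V)$. Hom-Novikov color Hom-algebra $(A,\cdot,\varepsilon,\alpha)$: $(x\cdot y)\cdot\alpha(z)-\alpha(x)\cdot(y\cdot z)=\varepsilon(x,y)\big((y\cdot x)\cdot\alpha(z)-\alpha(y)\cdot(x\cdot z)\big)$ and $(x\cdot y)\cdot\alpha(z)=\varepsilon(y,z)(x\cdot z)\cdot\alpha(y)$. A bimodule of it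 is a quadruple $(l,r,\beta,V)$, with $V$ a $\Gamma$-graded space and $\beta:V\to V$, $l,r:A\to\mathrm{End}(V)$ even linear, such that (1) $l(x\cdot y)\beta(v)-l(\alpha(x))l(y)v=\varepsilon(x,y)\big(l(y\cdot x)\beta(v)-l(\alpha(y))l(x)v\big)$; (2) $r(\alpha(y))l(x)v-l(\alpha(x))r(y)v=\varepsilon(x,v)\big(r(\alpha(y))r(x)v-r(x\cdot y)\beta(v)\big)$; (3) $r(\alpha(y))r(x)v-r(x\cdot y)\beta(v)=\varepsilon(v,x)\big(r(\alpha(y))l(x)v-l(\alpha(x))r(y)v\big)$; (4) $l(x\cdot y)\beta(v)=\varepsilon(y,v)r(\alpha(y))l(x)v$; (5) $r(\alpha(y))l(x)v=\varepsilon(v,y)l(x\cdot y)\beta(v)$; (6) $r(\alpha(y))r(x)v=\varepsilon(x,y)r(\alpha(x))r(y)v$. Hom-Lie color Hom-algebra $(A,[\cdot,\cdot],\varepsilon,\alpha)$: $[\cdot,\cdot]$ even bilinear, $\alpha$ even linear, $[x,y]=-\varepsilon(x,y)[y,x]$ and $\circlearrowleft_{x,y,z}\varepsilon(z,x)[\alpha(x),[y,z]]=0$ (cyclic sum over $(x,y,z)$). A representation of it is a triple $(\rho,\beta,V)$ with $\beta:V\to V$ and $\rho:A\to\mathrm{End}(V)$ even linear such that $\rho([x,y])\beta(v)=\rho(\alpha(x))\rho(y)v-\varepsilon(x,y)\rho(\alpha(y))\rho(x)v$. Hom-Gelfand-Dorfman color Hom-algebra $(A,\cdot,[\cdot,\cdot],\varepsilon,\alpha)$: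 $(A,\cdot,\varepsilon,\alpha)$ is Hom-Novikov, $(A,[\cdot,\cdot],\varepsilon,\alpha)$ is Hom-Lie, and $\alpha(y)\cdot[x,z]=\varepsilon(y,x)[\alpha(x),y\cdot z]-\varepsilon(x+y,z)[\alpha(z),y\cdot x]+[y,x]\cdot\alpha(z)-\varepsilon(x,z)[y,z]\cdot\alpha(x)$. A representation of a Hom-Gelfand-Dorfman color Hom-algebra is a quintuple $(l,r,\rho,\beta,V)$ such that $(l,r,\beta,V)$ is a bimodule of $(A,\cdot,\varepsilon,\alpha)$, $(\rho,\beta,V)$ is a representation of $(A,[\cdot,\cdot],\varepsilon,\alpha)$, and (a) $l(\alpha(y))\rho(x)v=\rho(y\cdot x)\beta(v)+\varepsilon(y,x)\rho(\alpha(x))l(y)v-\varepsilon(x,v)r(\alpha(x))\rho(y)v+l([y,x])\beta(v)$; (b) $r([x,y])\beta(v)=\varepsilon(v,x)\big(\rho(\alpha(x))r(y)v-r(\alpha(y))\rho(x)v\big)+\varepsilon(x+v,y)\big(r(\alpha(x))\rho(y)v-\rho(\alpha(y))r(x)v\big)$. *)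

theory Defs
  imports
    "HOL-Analysis.Product_Vector"
    "HOL-Computational_Algebra.Polynomial"
begin

text \<open>
  The group \<open>\<Gamma>\<close> is a type of class \<^class>\<open>ab_group_add\<close>, a linear space is a type of class
  \<^class>\<open>ab_group_add\<close> together with a scalar multiplication satisfying
  \<^locale>\<open>vector_space\<close>, and a grading is the family of its homogeneous components.
  Identities on homogeneous elements quantify over a degree \<open>a\<close> and an element of the
  component of degree \<open>a\<close>; so \<open>0\<close> occurs with every degree, where by linearity
  each of the identities holds trivially.
\<close>

section \<open>Graded linear spaces and commutation factors\<close>

definition homogeneous_decomposition ::
  "('g \<Rightarrow> 'a::ab_group_add set) \<Rightarrow> 'a \<Rightarrow> ('g \<Rightarrow> 'a) \<Rightarrow> bool"
  where "homogeneous_decomposition A x f \<longleftrightarrow>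
    (\<forall>a. f a \<in> A a) \<and> finite {a. f a \<noteq> 0} \<and> x = (\<Sum>a | f a \<noteq> 0. f a)"

locale graded_space = vector_space scale
  for scale :: "'k::field \<Rightarrow> 'a::ab_group_add \<Rightarrow> 'a"
    and A :: "'g::ab_group_add \<Rightarrow> 'a set" +
  assumes subspace_component: "\<And>a. subspace (A a)"
    and direct_sum: "\<And>x. \<exists>!f. homogeneous_decomposition A x f"

definition component ::
  "('g \<Rightarrow> 'a::ab_group_add set) \<Rightarrow> 'a \<Rightarrow> 'g \<Rightarrow> 'a"
  where "component A x = (THE f. homogeneous_decomposition A x f)"

definition even_map :: "('g \<Rightarrow> 'a set) \<Rightarrow> ('g \<Rightarrow> 'b set) \<Rightarrow> ('a \<Rightarrow> 'b) \<Rightarrow> bool"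
  where "even_map A B f \<longleftrightarrow> (\<forall>a. \<forall>x\<in>A a. f x \<in> B a)"

definition even_bimap ::
  "('g::ab_group_add \<Rightarrow> 'a set) \<Rightarrow> ('g \<Rightarrow> 'b set) \<Rightarrow> ('g \<Rightarrow> 'c set) \<Rightarrow> ('a \<Rightarrow> 'b \<Rightarrow> 'c) \<Rightarrow> bool"
  where "even_bimap A B C f \<longleftrightarrow> (\<forall>a b. \<forall>x\<in>A a. \<forall>y\<in>B b. f x y \<in> C (a + b))"

text \<open>
  Also used for linear maps \<open>A \<rightarrow> End(V)\<close>, written in curried form.
\<close>

definition bilinear_map ::
  "('k::field \<Rightarrow> 'a::ab_group_add \<Rightarrow> 'a) \<Rightarrow> ('k \<Rightarrow> 'b::ab_group_add \<Rightarrow> 'b) \<Rightarrow>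
   ('k \<Rightarrow> 'c::ab_group_add \<Rightarrow> 'c) \<Rightarrow> ('a \<Rightarrow> 'b \<Rightarrow> 'c) \<Rightarrow> bool"
  where "bilinear_map s1 s2 s3 f \<longleftrightarrow>
    (\<forall>x. Vector_Spaces.linear s2 s3 (\<lambda>y. f x y)) \<and>
    (\<forall>y. Vector_Spaces.linear s1 s3 (\<lambda>x. f x y))"

locale commutation_factor =
  fixes eps :: "'g::ab_group_add \<Rightarrow> 'g \<Rightarrow> 'k::field"
  assumes eps_nonzero: "eps a b \<noteq> 0"
    and eps_swap: "eps a b * eps b a = 1"
    and eps_add_right: "eps a (b + c) = eps a b * eps a c"
    and eps_add_left: "eps (a + b) c = eps a c * eps b c"

section \<open>Color Hom-algebras\<close>

locale color_hom_algebra = graded_space scale A + commutation_factor eps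
  for scale :: "'k::field \<Rightarrow> 'a::ab_group_add \<Rightarrow> 'a"
    and A :: "'g::ab_group_add \<Rightarrow> 'a set"
    and mul :: "'a \<Rightarrow> 'a \<Rightarrow> 'a"
    and eps :: "'g \<Rightarrow> 'g \<Rightarrow> 'k"
    and \<alpha> :: "'a \<Rightarrow> 'a" +
  assumes bilinear_mult: "bilinear_map scale scale scale mul"
    and even_mult: "even_bimap A A A mul"
    and linear_twist: "Vector_Spaces.linear scale scale \<alpha>"
    and even_twist: "even_map A A \<alpha>"

locale hom_novikov = color_hom_algebra scale A mul eps \<alpha>
  for scale :: "'k::field \<Rightarrow> 'a::ab_group_add \<Rightarrow> 'a"  (infixr \<open>*\<^sub>A\<close> 75)
    and A :: "'g::ab_group_add \<Rightarrow> 'a set"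
    and mul :: "'a \<Rightarrow> 'a \<Rightarrow> 'a"  (infixl \<open>\<cdot>\<close> 80)
    and eps :: "'g \<Rightarrow> 'g \<Rightarrow> 'k"
    and \<alpha> :: "'a \<Rightarrow> 'a" +
  assumes left_symmetric: "\<lbrakk>x \<in> A a; y \<in> A b; z \<in> A c\<rbrakk> \<Longrightarrow>
      (x \<cdot> y) \<cdot> \<alpha> z - \<alpha> x \<cdot> (y \<cdot> z) = eps a b *\<^sub>A ((y \<cdot> x) \<cdot> \<alpha> z - \<alpha> y \<cdot> (x \<cdot> z))"
    and right_commutative: "\<lbrakk>x \<in> A a; y \<in> A b; z \<in> A c\<rbrakk> \<Longrightarrow>
      (x \<cdot> y) \<cdot> \<alpha> z = eps b c *\<^sub>A ((x \<cdot> z) \<cdot> \<alpha> y)"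

locale hom_lie = color_hom_algebra scale A br eps \<alpha>
  for scale :: "'k::field \<Rightarrow> 'a::ab_group_add \<Rightarrow> 'a"  (infixr \<open>*\<^sub>A\<close> 75)
    and A :: "'g::ab_group_add \<Rightarrow> 'a set"
    and br :: "'a \<Rightarrow> 'a \<Rightarrow> 'a"
    and eps :: "'g \<Rightarrow> 'g \<Rightarrow> 'k"
    and \<alpha> :: "'a \<Rightarrow> 'a" +
  assumes skew_symmetric: "\<lbrakk>x \<in> A a; y \<in> A b\<rbrakk> \<Longrightarrow> br x y = - (eps a b *\<^sub>A br y x)"
    and jacobi: "\<lbrakk>x \<in> A a; y \<in> A b; z \<in> A c\<rbrakk> \<Longrightarrow>
      eps c a *\<^sub>A br (\<alpha> x) (br y z) + eps a b *\<^sub>A br (\<alpha> y) (br z x)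
        + eps b c *\<^sub>A br (\<alpha> z) (br x y) = 0"

locale hom_gelfand_dorfman =
  novikov: hom_novikov scale A mul eps \<alpha> + lie: hom_lie scale A br eps \<alpha>
  for scale :: "'k::field \<Rightarrow> 'a::ab_group_add \<Rightarrow> 'a"  (infixr \<open>*\<^sub>A\<close> 75)
    and A :: "'g::ab_group_add \<Rightarrow> 'a set"
    and mul :: "'a \<Rightarrow> 'a \<Rightarrow> 'a"  (infixl \<open>\<cdot>\<close> 80)
    and br :: "'a \<Rightarrow> 'a \<Rightarrow> 'a"
    and eps :: "'g \<Rightarrow> 'g \<Rightarrow> 'k"
    and \<alpha> :: "'a \<Rightarrow> 'a" +
  assumes gelfand_dorfman: "\<lbrakk>x \<in> A a; y \<in> A b; z \<in> A c\<rbrakk> \<Longrightarrow>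
      \<alpha> y \<cdot> br x z =
        eps b a *\<^sub>A br (\<alpha> x) (y \<cdot> z) - eps (a + b) c *\<^sub>A br (\<alpha> z) (y \<cdot> x)
        + br y x \<cdot> \<alpha> z - eps a c *\<^sub>A (br y z \<cdot> \<alpha> x)"

section \<open>Representations\<close>

locale hom_novikov_bimodule =
  alg: hom_novikov scaleA A mul eps \<alpha> + mod: graded_space scaleV V
  for scaleA :: "'k::field \<Rightarrow> 'a::ab_group_add \<Rightarrow> 'a"  (infixr \<open>*\<^sub>A\<close> 75)
    and A :: "'g::ab_group_add \<Rightarrow> 'a set"
    and mul :: "'a \<Rightarrow> 'a \<Rightarrow> 'a"  (infixl \<open>\<cdot>\<close> 80)
    and eps :: "'g \<Rightarrow> 'g \<Rightarrow> 'k"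
    and \<alpha> :: "'a \<Rightarrow> 'a"
    and l :: "'a \<Rightarrow> 'v::ab_group_add \<Rightarrow> 'v"
    and r :: "'a \<Rightarrow> 'v \<Rightarrow> 'v"
    and \<beta> :: "'v \<Rightarrow> 'v"
    and scaleV :: "'k \<Rightarrow> 'v \<Rightarrow> 'v"  (infixr \<open>*\<^sub>V\<close> 75)
    and V :: "'g \<Rightarrow> 'v set" +
  assumes linear_twist: "Vector_Spaces.linear scaleV scaleV \<beta>"
    and even_twist: "even_map V V \<beta>"
    and linear_left: "bilinear_map scaleA scaleV scaleV l"
    and even_left: "even_bimap A V V l"
    and linear_right: "bilinear_map scaleA scaleV scaleV r"
    and even_right: "even_bimap A V V r"
    and bimodule_1: "\<lbrakk>x \<in> A a; y \<in> A b; v \<in> V c\<rbrakk> \<Longrightarrow>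
      l (x \<cdot> y) (\<beta> v) - l (\<alpha> x) (l y v)
        = eps a b *\<^sub>V (l (y \<cdot> x) (\<beta> v) - l (\<alpha> y) (l x v))"
    and bimodule_2: "\<lbrakk>x \<in> A a; y \<in> A b; v \<in> V c\<rbrakk> \<Longrightarrow>
      r (\<alpha> y) (l x v) - l (\<alpha> x) (r y v)
        = eps a c *\<^sub>V (r (\<alpha> y) (r x v) - r (x \<cdot> y) (\<beta> v))"
    and bimodule_3: "\<lbrakk>x \<in> A a; y \<in> A b; v \<in> V c\<rbrakk> \<Longrightarrow>
      r (\<alpha> y) (r x v) - r (x \<cdot> y) (\<beta> v)
        = eps c a *\<^sub>V (r (\<alpha> y) (l x v) - l (\<alpha> x) (r y v))"
    and bimodule_4: "\<lbrakk>x \<in> A a; y \<in> A b; v \<in> V c\<rbrakk> \<Longrightarrow>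
      l (x \<cdot> y) (\<beta> v) = eps b c *\<^sub>V r (\<alpha> y) (l x v)"
    and bimodule_5: "\<lbrakk>x \<in> A a; y \<in> A b; v \<in> V c\<rbrakk> \<Longrightarrow>
      r (\<alpha> y) (l x v) = eps c b *\<^sub>V l (x \<cdot> y) (\<beta> v)"
    and bimodule_6: "\<lbrakk>x \<in> A a; y \<in> A b; v \<in> V c\<rbrakk> \<Longrightarrow>
      r (\<alpha> y) (r x v) = eps a b *\<^sub>V r (\<alpha> x) (r y v)"

locale hom_lie_representation =
  alg: hom_lie scaleA A br eps \<alpha> + mod: graded_space scaleV V
  for scaleA :: "'k::field \<Rightarrow> 'a::ab_group_add \<Rightarrow> 'a"  (infixr \<open>*\<^sub>A\<close> 75)
    and A :: "'g::ab_group_add \<Rightarrow> 'a set"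
    and br :: "'a \<Rightarrow> 'a \<Rightarrow> 'a"
    and eps :: "'g \<Rightarrow> 'g \<Rightarrow> 'k"
    and \<alpha> :: "'a \<Rightarrow> 'a"
    and \<rho> :: "'a \<Rightarrow> 'v::ab_group_add \<Rightarrow> 'v"
    and \<beta> :: "'v \<Rightarrow> 'v"
    and scaleV :: "'k \<Rightarrow> 'v \<Rightarrow> 'v"  (infixr \<open>*\<^sub>V\<close> 75)
    and V :: "'g \<Rightarrow> 'v set" +
  assumes linear_twist: "Vector_Spaces.linear scaleV scaleV \<beta>"
    and even_twist: "even_map V V \<beta>"
    and linear_action: "bilinear_map scaleA scaleV scaleV \<rho>"
    and even_action: "even_bimap A V V \<rho>"
    and representation: "\<lbrakk>x \<in> A a; y \<in> A b; v \<in> V c\<rbrakk> \<Longrightarrow>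
      \<rho> (br x y) (\<beta> v) = \<rho> (\<alpha> x) (\<rho> y v) - eps a b *\<^sub>V \<rho> (\<alpha> y) (\<rho> x v)"

locale hom_gelfand_dorfman_representation =
  alg: hom_gelfand_dorfman scaleA A mul br eps \<alpha> +
  bimodule: hom_novikov_bimodule scaleA A mul eps \<alpha> l r \<beta> scaleV V +
  lie_rep: hom_lie_representation scaleA A br eps \<alpha> \<rho> \<beta> scaleV V
  for scaleA :: "'k::field \<Rightarrow> 'a::ab_group_add \<Rightarrow> 'a"  (infixr \<open>*\<^sub>A\<close> 75)
    and A :: "'g::ab_group_add \<Rightarrow> 'a set"
    and mul :: "'a \<Rightarrow> 'a \<Rightarrow> 'a"  (infixl \<open>\<cdot>\<close> 80)
    and br :: "'a \<Rightarrow> 'a \<Rightarrow> 'a"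
    and eps :: "'g \<Rightarrow> 'g \<Rightarrow> 'k"
    and \<alpha> :: "'a \<Rightarrow> 'a"
    and l :: "'a \<Rightarrow> 'v::ab_group_add \<Rightarrow> 'v"
    and r :: "'a \<Rightarrow> 'v \<Rightarrow> 'v"
    and \<rho> :: "'a \<Rightarrow> 'v \<Rightarrow> 'v"
    and \<beta> :: "'v \<Rightarrow> 'v"
    and scaleV :: "'k \<Rightarrow> 'v \<Rightarrow> 'v"  (infixr \<open>*\<^sub>V\<close> 75)
    and V :: "'g \<Rightarrow> 'v set" +
  assumes compatible_left: "\<lbrakk>x \<in> A a; y \<in> A b; v \<in> V c\<rbrakk> \<Longrightarrow>
      l (\<alpha> y) (\<rho> x v) =
        \<rho> (y \<cdot> x) (\<beta> v) + eps b a *\<^sub>V \<rho> (\<alpha> x) (l y v)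
        - eps a c *\<^sub>V r (\<alpha> x) (\<rho> y v) + l (br y x) (\<beta> v)"
    and compatible_right: "\<lbrakk>x \<in> A a; y \<in> A b; v \<in> V c\<rbrakk> \<Longrightarrow>
      r (br x y) (\<beta> v) =
        eps c a *\<^sub>V (\<rho> (\<alpha> x) (r y v) - r (\<alpha> y) (\<rho> x v))
        + eps (a + c) b *\<^sub>V (r (\<alpha> x) (\<rho> y v) - \<rho> (\<alpha> y) (r x v))"

section \<open>The semidirect product on the direct sum\<close>

text \<open>
  The direct sum of \<open>A\<close> and \<open>V\<close> is the product type with scalar
  multiplication \<^const>\<open>module_prod.scale\<close>.
\<close>

definition sum_grading :: "('g \<Rightarrow> 'a set) \<Rightarrow> ('g \<Rightarrow> 'v set) \<Rightarrow> 'g \<Rightarrow> ('a \<times> 'v) set"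
  where "sum_grading A V a = A a \<times> V a"

definition semidirect_mult ::
  "('a \<Rightarrow> 'a \<Rightarrow> 'a) \<Rightarrow> ('a \<Rightarrow> 'v::ab_group_add \<Rightarrow> 'v) \<Rightarrow> ('a \<Rightarrow> 'v \<Rightarrow> 'v) \<Rightarrow>
   'a \<times> 'v \<Rightarrow> 'a \<times> 'v \<Rightarrow> 'a \<times> 'v"
  where "semidirect_mult mul l r p q =
    (mul (fst p) (fst q), l (fst p) (snd q) + r (fst q) (snd p))"

text \<open>
  The formula for the bracket involves the degrees of its arguments; it is extended
  bilinearly from homogeneous elements by summing over the homogeneous components.
\<close>

definition homogeneous_bracket ::
  "('a \<Rightarrow> 'a \<Rightarrow> 'a) \<Rightarrow> ('g \<Rightarrow> 'g \<Rightarrow> 'k) \<Rightarrow> ('a \<Rightarrow> 'v::ab_group_add \<Rightarrow> 'v) \<Rightarrow>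
   ('k \<Rightarrow> 'v \<Rightarrow> 'v) \<Rightarrow> 'g \<Rightarrow> 'g \<Rightarrow> 'a \<times> 'v \<Rightarrow> 'a \<times> 'v \<Rightarrow> 'a \<times> 'v"
  where "homogeneous_bracket br eps \<rho> scaleV a b p q =
    (br (fst p) (fst q), \<rho> (fst p) (snd q) - scaleV (eps a b) (\<rho> (fst q) (snd p)))"

definition semidirect_bracket ::
  "('g \<Rightarrow> 'a::ab_group_add set) \<Rightarrow> ('a \<Rightarrow> 'a \<Rightarrow> 'a) \<Rightarrow> ('g \<Rightarrow> 'g \<Rightarrow> 'k) \<Rightarrow>
   ('a \<Rightarrow> 'v::ab_group_add \<Rightarrow> 'v) \<Rightarrow> ('k \<Rightarrow> 'v \<Rightarrow> 'v) \<Rightarrow> ('g \<Rightarrow> 'v set) \<Rightarrow>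
   'a \<times> 'v \<Rightarrow> 'a \<times> 'v \<Rightarrow> 'a \<times> 'v"
  where "semidirect_bracket A br eps \<rho> scaleV V p q =
    (let P = component (sum_grading A V) p; Q = component (sum_grading A V) q in
      \<Sum>a | P a \<noteq> 0. \<Sum>b | Q b \<noteq> 0. homogeneous_bracket br eps \<rho> scaleV a b (P a) (Q b))"

lemma semidirect_bracket_homogeneous:
  assumes "hom_gelfand_dorfman_representation scaleA A mul br eps \<alpha> l r \<rho> \<beta> scaleV V"
    and x: "x \<in> A a" "y \<in> A b" and v: "v \<in> V a" "w \<in> V b"
  shows "semidirect_bracket A br eps \<rho> scaleV V (x, v) (y, w) =
    (br x y, \<rho> x w - scaleV (eps a b) (\<rho> y v))"
proof -
  interpret R: hom_gelfand_dorfman_representation scaleA A mul br eps \<alpha> l r \<rho> \<beta> scaleV V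
    by fact
  have zA: "0 \<in> A c" for c
    using R.alg.novikov.subspace_component R.alg.novikov.subspace_0 by blast
  have zV: "0 \<in> V c" for c
    using R.bimodule.mod.subspace_component R.bimodule.mod.subspace_0 by blast
  have decA: "homogeneous_decomposition A u (\<lambda>d. if d = c then u else 0)" if "u \<in> A c" for u c
    using that zA by (cases "u = 0") (auto simp: homogeneous_decomposition_def)
  have decV: "homogeneous_decomposition V u (\<lambda>d. if d = c then u else 0)" if "u \<in> V c" for u c
    using that zV by (cases "u = 0") (auto simp: homogeneous_decomposition_def)
  have split: "homogeneous_decomposition A (fst p) (fst \<circ> f) \<and> homogeneous_decomposition V (snd p) (snd \<circ> f)"
    if f: "homogeneous_decomposition (sum_grading A V) p f" for p f
  proof -
    have fin: "finite {a. f a \<noteq> 0}" and p: "p = (\<Sum>a | f a \<noteq> 0. f a)"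
      and mem: "\<And>a. f a \<in> A a \<times> V a"
      using f by (auto simp: homogeneous_decomposition_def sum_grading_def)
    have 1: "{a. fst (f a) \<noteq> 0} \<subseteq> {a. f a \<noteq> 0}" "{a. snd (f a) \<noteq> 0} \<subseteq> {a. f a \<noteq> 0}"
      by auto
    have "fst p = (\<Sum>a | f a \<noteq> 0. fst (f a))" "snd p = (\<Sum>a | f a \<noteq> 0. snd (f a))"
      unfolding p by (simp_all add: fst_sum snd_sum)
    moreover have "(\<Sum>a | f a \<noteq> 0. fst (f a)) = (\<Sum>a | fst (f a) \<noteq> 0. fst (f a))"
      by (rule sum.mono_neutral_right[OF fin 1(1)]) auto
    moreover have "(\<Sum>a | f a \<noteq> 0. snd (f a)) = (\<Sum>a | snd (f a) \<noteq> 0. snd (f a))"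
      by (rule sum.mono_neutral_right[OF fin 1(2)]) auto
    ultimately show ?thesis
      using mem 1 finite_subset[OF 1(1) fin] finite_subset[OF 1(2) fin]
      by (auto simp: homogeneous_decomposition_def mem_Times_iff)
  qed
  have comp: "component (sum_grading A V) (u, t) = (\<lambda>d. if d = c then (u, t) else 0)"
    if u: "u \<in> A c" "t \<in> V c" for u t c
    unfolding component_def
  proof (rule the_equality)
    show "homogeneous_decomposition (sum_grading A V) (u, t) (\<lambda>d. if d = c then (u, t) else 0)"
      using u zA zV by (cases "(u, t) = 0")
        (auto simp: homogeneous_decomposition_def sum_grading_def zero_prod_def)
  next
    fix f assume f: "homogeneous_decomposition (sum_grading A V) (u, t) f"
    have "fst \<circ> f = (\<lambda>d. if d = c then u else 0)"
      using split[OF f] decA[OF u(1)] R.alg.novikov.direct_sum[of u] by auto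
    moreover have "snd \<circ> f = (\<lambda>d. if d = c then t else 0)"
      using split[OF f] decV[OF u(2)] R.bimodule.mod.direct_sum[of t] by auto
    ultimately show "f = (\<lambda>d. if d = c then (u, t) else 0)"
      by (auto simp: fun_eq_iff prod_eq_iff)
  qed
  have lin: "Vector_Spaces.linear scaleA scaleA (\<lambda>y. br x y)" "Vector_Spaces.linear scaleA scaleA (\<lambda>x. br x y)"
    "Vector_Spaces.linear scaleV scaleV (\<lambda>v. \<rho> x v)" "Vector_Spaces.linear scaleA scaleV (\<lambda>x. \<rho> x v)" for x y v
    using R.alg.lie.bilinear_mult R.lie_rep.linear_action by (auto simp: bilinear_map_def)
  have zero: "br 0 y = 0" "br x 0 = 0" "\<rho> 0 v = 0" "\<rho> x 0 = 0" for x y v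
    using lin[THEN Vector_Spaces.linear.axioms(3), THEN module_hom.zero] by auto
  have "homogeneous_bracket br eps \<rho> scaleV a b 0 q = 0" "homogeneous_bracket br eps \<rho> scaleV a b q 0 = 0" for q
    by (simp_all add: homogeneous_bracket_def zero zero_prod_def R.bimodule.mod.scale_zero_right)
  then show ?thesis
    unfolding semidirect_bracket_def comp[OF x(1) v(1)] comp[OF x(2) v(2)] Let_def
    by (cases "(x, v) = 0"; cases "(y, w) = 0")
      (auto simp: homogeneous_bracket_def zero zero_prod_def R.bimodule.mod.scale_zero_right)
qed

end

theory Submission
  imports Defs
begin

text \<open>
  The \<open>V\<close>-component of each identity on \<open>A \<oplus> V\<close> is a sum of terms containing exactly one of
  the module arguments \<open>u\<close>, \<open>v\<close>, \<open>w\<close>, and the part belonging to each of them is one axiom of the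
  representation, up to a factor that the rules for \<open>\<epsilon>\<close> cancel. Bilinearity of the bracket
  away from homogeneous elements follows from linearity of the homogeneous components.
\<close>

section \<open>Graded linear spaces\<close>

text \<open>Summands may cancel when decompositions are added, so the exact support of the result is
  awkward to describe. Any finite set containing the support gives the same sum, and such a set is
  easy to name.\<close>

lemma homogeneous_decomposition_iff:
  "homogeneous_decomposition A x f \<longleftrightarrow>
    (\<forall>a. f a \<in> A a) \<and> (\<exists>S. finite S \<and> (\<forall>a. a \<notin> S \<longrightarrow> f a = 0) \<and> x = sum f S)"
proof -
  have "finite {a. f a \<noteq> 0} \<and> sum f {a. f a \<noteq> 0} = sum f S"
    if "finite S" "\<forall>a. a \<notin> S \<longrightarrow> f a = 0" for S
  proof -
    have sub: "{a. f a \<noteq> 0} \<subseteq> S"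
      using that by auto
    then show ?thesis
      using sum.mono_neutral_left[OF that(1) sub, of f] finite_subset[OF sub that(1)] by auto
  qed
  then show ?thesis
    unfolding homogeneous_decomposition_def by (metis (mono_tags, lifting) mem_Collect_eq)
qed

context graded_space
begin

lemma homogeneous_decomposition_component: "homogeneous_decomposition A x (component A x)"
  unfolding component_def by (rule theI'[OF direct_sum])

lemma component_eqI: "homogeneous_decomposition A x f \<Longrightarrow> component A x = f"
  using direct_sum homogeneous_decomposition_component by blast

lemma finite_component: "finite {a. component A x a \<noteq> 0}"
  using homogeneous_decomposition_component[of x] by (simp add: homogeneous_decomposition_def)

text \<open>By uniqueness it suffices that the pointwise sum of the two decompositions decomposes
  \<open>x + y\<close>; the union \<open>?S\<close> of their supports serves as index set for
  both.\<close>

lemma component_add: "component A (x + y) a = component A x a + component A y a"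
proof -
  let ?f = "component A x" and ?g = "component A y"
  let ?S = "{a. ?f a \<noteq> 0} \<union> {a. ?g a \<noteq> 0}"
  have f: "\<And>a. ?f a \<in> A a" "x = sum ?f {a. ?f a \<noteq> 0}"
    and g: "\<And>a. ?g a \<in> A a" "y = sum ?g {a. ?g a \<noteq> 0}"
    using homogeneous_decomposition_component by (auto simp: homogeneous_decomposition_def)
  have fin: "finite ?S"
    by (simp add: finite_component)
  have "sum ?f {a. ?f a \<noteq> 0} = sum ?f ?S" "sum ?g {a. ?g a \<noteq> 0} = sum ?g ?S"
    by (rule sum.mono_neutral_left[OF fin]; auto)+
  then have "x + y = (\<Sum>a\<in>?S. ?f a + ?g a)"
    using f(2) g(2) by (simp add: sum.distrib)
  then have "homogeneous_decomposition A (x + y) (\<lambda>a. ?f a + ?g a)"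
    unfolding homogeneous_decomposition_iff
    using fin f(1) g(1) subspace_add[OF subspace_component]
    by (intro conjI exI[of _ ?S]) auto
  then show ?thesis
    by (simp add: component_eqI)
qed

lemma component_scale: "component A (scale c x) a = scale c (component A x a)"
proof -
  let ?f = "component A x"
  have f: "\<And>a. ?f a \<in> A a" "x = sum ?f {a. ?f a \<noteq> 0}"
    using homogeneous_decomposition_component by (auto simp: homogeneous_decomposition_def)
  have "scale c x = (\<Sum>a | ?f a \<noteq> 0. scale c (?f a))"
    using f(2) by (metis scale_sum_right)
  then have "homogeneous_decomposition A (scale c x) (\<lambda>a. scale c (?f a))"
    unfolding homogeneous_decomposition_iff
    using finite_component f(1) subspace_scale[OF subspace_component]
    by (intro conjI exI[of _ "{a. ?f a \<noteq> 0}"]) auto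
  then show ?thesis
    by (simp add: component_eqI)
qed

end

section \<open>Bilinear extension of maps given degree by degree\<close>

lemma bilinear_map_iff:
  "bilinear_map s1 s2 s3 f \<longleftrightarrow> vector_space s1 \<and> vector_space s2 \<and> vector_space s3 \<and>
    (\<forall>x y y'. f x (y + y') = f x y + f x y') \<and> (\<forall>c x y. f x (s2 c y) = s3 c (f x y)) \<and>
    (\<forall>x x' y. f (x + x') y = f x y + f x' y) \<and> (\<forall>c x y. f (s1 c x) y = s3 c (f x y))"
  unfolding bilinear_map_def Vector_Spaces.linear_iff by auto

lemma bilinear_map_zero:
  assumes "bilinear_map s1 s2 s3 f"
  shows "f 0 y = 0" "f x 0 = 0"
  using assms by (metis add_cancel_right_right bilinear_map_iff)+

text \<open>\<open>semidirect_bracket\<close> is built in this way from a formula that depends on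
  the degrees. Components depend linearly on the element, so the only obstacle is that the index
  sets vary with the arguments.\<close>

lemma bilinear_map_componentwise:
  assumes "graded_space s1 A" "graded_space s2 B"
    and h: "\<And>a b. bilinear_map s1 s2 s3 (h a b)"
  shows "bilinear_map s1 s2 s3 (\<lambda>p q. let P = component A p; Q = component B q in
    \<Sum>a | P a \<noteq> 0. \<Sum>b | Q b \<noteq> 0. h a b (P a) (Q b))" (is "bilinear_map _ _ _ ?H")
proof -
  interpret A: graded_space s1 A by fact
  interpret B: graded_space s2 B by fact
  interpret C: vector_space s3 using h by (auto simp: bilinear_map_iff)
  let ?P = "component A" and ?Q = "component B"
  \<comment> \<open>A summand vanishes as soon as one of its two components is 0, so the supports
    may be enlarged to any finite sets \<open>S\<close> and \<open>T\<close>. Each equation below is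
    then checked term by term over common index sets.\<close>
  have H: "?H p q = (\<Sum>a\<in>S. \<Sum>b\<in>T. h a b (?P p a) (?Q q b))"
    if S: "finite S" "{a. ?P p a \<noteq> 0} \<subseteq> S" and T: "finite T" "{b. ?Q q b \<noteq> 0} \<subseteq> T" for p q S T
  proof -
    have "?H p q = (\<Sum>a | ?P p a \<noteq> 0. \<Sum>b\<in>T. h a b (?P p a) (?Q q b))"
      unfolding Let_def
      by (intro sum.cong refl sum.mono_neutral_left T) (auto simp: bilinear_map_zero[OF h])
    also have "\<dots> = (\<Sum>a\<in>S. \<Sum>b\<in>T. h a b (?P p a) (?Q q b))"
      by (intro sum.mono_neutral_left S) (auto simp: bilinear_map_zero[OF h])
    finally show ?thesis .
  qed
  have add: "h a b x (y + y') = h a b x y + h a b x y'" "h a b (x + x') y = h a b x y + h a b x' y"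
    and scale: "h a b x (s2 c y) = s3 c (h a b x y)" "h a b (s1 c x) y = s3 c (h a b x y)"
    for a b x x' y y' c
    using h[of a b] by (auto simp: bilinear_map_iff)
  show ?thesis
    unfolding bilinear_map_iff
  proof (intro conjI allI)
    show "vector_space s1" "vector_space s2" "vector_space s3"
      by unfold_locales
  next
    fix p q q'
    \<comment> \<open>The union also contains the support of \<open>q + q'\<close>, so all three
      sums run over the same pairs of degrees.\<close>
    let ?S = "{a. ?P p a \<noteq> 0}" and ?T = "{b. ?Q q b \<noteq> 0} \<union> {b. ?Q q' b \<noteq> 0}"
    have fin: "finite ?S" "finite ?T"
      by (auto simp: A.finite_component B.finite_component)
    show "?H p (q + q') = ?H p q + ?H p q'"
      by (subst (1 2 3) H[OF fin(1) _ fin(2)])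
        (auto simp: B.component_add add sum.distrib)
  next
    fix c p q
    \<comment> \<open>The support of \<open>q\<close> also contains that of its multiple by
      \<open>c\<close>, which is empty when \<open>c = 0\<close>.\<close>
    let ?S = "{a. ?P p a \<noteq> 0}" and ?T = "{b. ?Q q b \<noteq> 0}"
    have fin: "finite ?S" "finite ?T"
      by (auto simp: A.finite_component B.finite_component)
    show "?H p (s2 c q) = s3 c (?H p q)"
      by (subst (1 2) H[OF fin(1) _ fin(2)])
        (auto simp: B.component_scale scale C.scale_sum_right)
  next
    fix p p' q
    let ?S = "{a. ?P p a \<noteq> 0} \<union> {a. ?P p' a \<noteq> 0}" and ?T = "{b. ?Q q b \<noteq> 0}"
    have fin: "finite ?S" "finite ?T"
      by (auto simp: A.finite_component B.finite_component)
    show "?H (p + p') q = ?H p q + ?H p' q"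
      by (subst (1 2 3) H[OF fin(1) _ fin(2)])
        (auto simp: A.component_add add sum.distrib)
  next
    fix c p q
    let ?S = "{a. ?P p a \<noteq> 0}" and ?T = "{b. ?Q q b \<noteq> 0}"
    have fin: "finite ?S" "finite ?T"
      by (auto simp: A.finite_component B.finite_component)
    show "?H (s1 c p) q = s3 c (?H p q)"
      by (subst (1 2) H[OF fin(1) _ fin(2)])
        (auto simp: A.component_scale scale C.scale_sum_right)
  qed
qed

text \<open>This reduces existence and uniqueness of decompositions in the direct sum to the two
  factors. The coordinates of \<open>f\<close> may have different supports, so the converse sums
  over the union of \<open>S\<close> and \<open>T\<close>.\<close>

lemma homogeneous_decomposition_sum_grading:
  "homogeneous_decomposition (sum_grading A V) p f \<longleftrightarrow>
    homogeneous_decomposition A (fst p) (fst \<circ> f) \<and> homogeneous_decomposition V (snd p) (snd \<circ> f)"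
  (is "?L \<longleftrightarrow> ?R")
proof
  assume ?L
  then obtain S where "\<forall>a. f a \<in> A a \<times> V a" "finite S" "\<forall>a. a \<notin> S \<longrightarrow> f a = 0" "p = sum f S"
    by (auto simp: homogeneous_decomposition_iff sum_grading_def)
  then show ?R
    unfolding homogeneous_decomposition_iff
    by (auto simp: fst_sum snd_sum mem_Times_iff intro!: exI[of _ S])
next
  assume R: ?R
  then obtain S T where S: "finite S" "\<And>a. a \<notin> S \<Longrightarrow> fst (f a) = 0" "fst p = sum (fst \<circ> f) S"
    and T: "finite T" "\<And>a. a \<notin> T \<Longrightarrow> snd (f a) = 0" "snd p = sum (snd \<circ> f) T"
    by (auto simp: homogeneous_decomposition_iff)
  have "sum (fst \<circ> f) S = sum (fst \<circ> f) (S \<union> T)" "sum (snd \<circ> f) T = sum (snd \<circ> f) (S \<union> T)"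
    using S T by (auto intro!: sum.mono_neutral_left)
  then have "p = sum f (S \<union> T)"
    using S(3) T(3) by (simp add: prod_eq_iff fst_sum snd_sum)
  then show ?L
    using R S(1,2) T(1,2) unfolding homogeneous_decomposition_iff
    by (intro conjI exI[of _ "S \<union> T"]) (auto simp: sum_grading_def mem_Times_iff prod_eq_iff)
qed

lemma prod_scale_eq:
  assumes "vector_space s1" "vector_space s2"
  shows "module_prod.scale s1 s2 c p = (s1 c (fst p), s2 c (snd p))"
proof -
  interpret vector_space_prod s1 s2
    using assms by (simp add: vector_space_pair_def vector_space_prod_def)
  show ?thesis
    by (rule scale_def)
qed

lemma graded_space_sum_grading:
  assumes "graded_space s1 A" "graded_space s2 V"
  shows "graded_space (module_prod.scale s1 s2) (sum_grading A V)"
proof -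
  interpret A: graded_space s1 A by fact
  interpret V: graded_space s2 V by fact
  interpret vector_space_prod s1 s2 by unfold_locales
  show ?thesis
  proof
    show "p.subspace (sum_grading A V a)" for a
      unfolding sum_grading_def
      by (intro subspace_Times A.subspace_component V.subspace_component)
    show "\<exists>!f. homogeneous_decomposition (sum_grading A V) p f" for p
    proof
      show "homogeneous_decomposition (sum_grading A V) p
          (\<lambda>a. (component A (fst p) a, component V (snd p) a))"
        unfolding homogeneous_decomposition_sum_grading
        by (simp add: comp_def A.homogeneous_decomposition_component
            V.homogeneous_decomposition_component)
    next
      fix f assume "homogeneous_decomposition (sum_grading A V) p f"
      then have "component A (fst p) = fst \<circ> f" "component V (snd p) = snd \<circ> f"
        by (auto simp: homogeneous_decomposition_sum_grading
            intro: A.component_eqI V.component_eqI)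
      then show "f = (\<lambda>a. (component A (fst p) a, component V (snd p) a))"
        by simp
    qed
  qed
qed

section \<open>The semidirect product\<close>

text \<open>Adds three instances of representation axioms, one for each of the module arguments,
  into a single equation for the \<open>V\<close>-coordinate.\<close>

lemma add_eqs: "t = t' \<Longrightarrow> u = u' \<Longrightarrow> v = v' \<Longrightarrow> t + u + v = t' + u' + v'"
  for t u v :: "'a::plus"
  by simp

text \<open>Forms of \<open>eps_swap\<close> for products in which a further factor stands beside or
  between the two that cancel.\<close>

lemma (in commutation_factor) eps_swap_cancel:
  "eps a b * (eps b a * c) = c" "eps a b * (c * eps b a) = c"
  using eps_swap[of a b] by (simp_all add: mult.left_commute[of _ c] flip: mult.assoc)

section \<open>Bilinearity and evenness of the operations on the direct sum\<close>

context hom_gelfand_dorfman_representation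
begin

abbreviation "scaleAV \<equiv> module_prod.scale scaleA scaleV"
abbreviation "gradingAV \<equiv> sum_grading A V"
abbreviation "mulAV \<equiv> semidirect_mult mul l r"
abbreviation "brAV \<equiv> semidirect_bracket A br eps \<rho> scaleV V"
abbreviation "twistAV \<equiv> map_prod \<alpha> \<beta>"

sublocale AV: graded_space scaleAV gradingAV
  by (intro graded_space_sum_grading) unfold_locales

lemma bilinear_props:
  "bilinear_map scaleA scaleA scaleA mul" "bilinear_map scaleA scaleA scaleA br"
  "bilinear_map scaleA scaleV scaleV l" "bilinear_map scaleA scaleV scaleV r"
  "bilinear_map scaleA scaleV scaleV \<rho>"
  using alg.novikov.bilinear_mult alg.lie.bilinear_mult bimodule.linear_left
    bimodule.linear_right lie_rep.linear_action by auto

lemma linear_rules: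
  "x \<cdot> (y + y') = x \<cdot> y + x \<cdot> y'" "(x + x') \<cdot> y = x \<cdot> y + x' \<cdot> y"
  "x \<cdot> (c *\<^sub>A y) = c *\<^sub>A (x \<cdot> y)" "(c *\<^sub>A x) \<cdot> y = c *\<^sub>A (x \<cdot> y)"
  "br x (y + y') = br x y + br x y'" "br (x + x') y = br x y + br x' y"
  "br x (c *\<^sub>A y) = c *\<^sub>A br x y" "br (c *\<^sub>A x) y = c *\<^sub>A br x y"
  "l x (v + v') = l x v + l x v'" "l (x + x') v = l x v + l x' v"
  "l x (c *\<^sub>V v) = c *\<^sub>V l x v" "l (c *\<^sub>A x) v = c *\<^sub>V l x v"
  "r x (v + v') = r x v + r x v'" "r (x + x') v = r x v + r x' v"
  "r x (c *\<^sub>V v) = c *\<^sub>V r x v" "r (c *\<^sub>A x) v = c *\<^sub>V r x v"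
  "\<rho> x (v + v') = \<rho> x v + \<rho> x v'" "\<rho> (x + x') v = \<rho> x v + \<rho> x' v"
  "\<rho> x (c *\<^sub>V v) = c *\<^sub>V \<rho> x v" "\<rho> (c *\<^sub>A x) v = c *\<^sub>V \<rho> x v"
  "\<alpha> (x + x') = \<alpha> x + \<alpha> x'" "\<alpha> (c *\<^sub>A x) = c *\<^sub>A \<alpha> x"
  "\<beta> (v + v') = \<beta> v + \<beta> v'" "\<beta> (c *\<^sub>V v) = c *\<^sub>V \<beta> v"
  using bilinear_props[unfolded bilinear_map_iff] alg.novikov.linear_twist bimodule.linear_twist
  unfolding Vector_Spaces.linear_iff by auto

lemma diff_rules:
  "l x (v - v') = l x v - l x v'" "r x (v - v') = r x v - r x v'" "\<rho> x (v - v') = \<rho> x v - \<rho> x v'"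
  by (metis add_diff_cancel diff_add_cancel linear_rules)+

lemma even_rules:
  "x \<in> A a \<Longrightarrow> y \<in> A b \<Longrightarrow> x \<cdot> y \<in> A (a + b)"
  "x \<in> A a \<Longrightarrow> y \<in> A b \<Longrightarrow> br x y \<in> A (a + b)"
  "x \<in> A a \<Longrightarrow> v \<in> V b \<Longrightarrow> l x v \<in> V (a + b)"
  "x \<in> A a \<Longrightarrow> v \<in> V b \<Longrightarrow> r x v \<in> V (a + b)"
  "x \<in> A a \<Longrightarrow> v \<in> V b \<Longrightarrow> \<rho> x v \<in> V (a + b)"
  "x \<in> A a \<Longrightarrow> \<alpha> x \<in> A a"
  "v \<in> V a \<Longrightarrow> \<beta> v \<in> V a"
  using alg.novikov.even_mult alg.lie.even_mult bimodule.even_left bimodule.even_right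
    lie_rep.even_action alg.novikov.even_twist bimodule.even_twist
  unfolding even_bimap_def even_map_def by auto

lemmas subspace_rules =
  bimodule.mod.subspace_add[OF bimodule.mod.subspace_component]
  bimodule.mod.subspace_diff[OF bimodule.mod.subspace_component]
  bimodule.mod.subspace_scale[OF bimodule.mod.subspace_component]

lemma scaleAV_eq: "scaleAV c p = (c *\<^sub>A fst p, c *\<^sub>V snd p)"
  by (intro prod_scale_eq) unfold_locales

text \<open>The degrees \<open>a\<close> and \<open>b\<close> enter the right-hand side and must
  come from the membership facts, so later uses supply these facts explicitly.\<close>

lemma brAV_eq:
  assumes "p \<in> gradingAV a" "q \<in> gradingAV b"
  shows "brAV p q = (br (fst p) (fst q), \<rho> (fst p) (snd q) - eps a b *\<^sub>V \<rho> (fst q) (snd p))"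
  using semidirect_bracket_homogeneous[OF hom_gelfand_dorfman_representation_axioms,
      of "fst p" a "fst q" b "snd p" "snd q"] assms
  by (auto simp: sum_grading_def)

lemma bilinear_mulAV: "bilinear_map scaleAV scaleAV scaleAV mulAV"
  unfolding bilinear_map_iff
  by (auto simp: AV.vector_space_axioms semidirect_mult_def scaleAV_eq linear_rules
      bimodule.mod.scale_right_distrib algebra_simps)

text \<open>For fixed degrees \<open>a\<close> and \<open>b\<close> the factor
  \<open>eps a b\<close> is a constant, so \<open>homogeneous_bracket\<close> is bilinear on the
  whole direct sum and its componentwise extension is too.\<close>

lemma bilinear_brAV: "bilinear_map scaleAV scaleAV scaleAV brAV"
  unfolding semidirect_bracket_def
proof (rule bilinear_map_componentwise)
  show "graded_space scaleAV gradingAV" "graded_space scaleAV gradingAV"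
    by unfold_locales
  show "bilinear_map scaleAV scaleAV scaleAV (homogeneous_bracket br eps \<rho> scaleV a b)" for a b
    unfolding bilinear_map_iff
    by (auto simp: AV.vector_space_axioms homogeneous_bracket_def scaleAV_eq linear_rules
        bimodule.mod.scale_right_distrib bimodule.mod.scale_right_diff_distrib algebra_simps)
qed

lemma mulAV_in: "p \<in> gradingAV a \<Longrightarrow> q \<in> gradingAV b \<Longrightarrow> mulAV p q \<in> gradingAV (a + b)"
  \<comment> \<open>The right action puts the algebra element first, so its term has degree
    \<open>b + a\<close>; commutativity of the group turns this into \<open>a + b\<close>.\<close>
  using even_rules(4)[of "fst q" b "snd p" a]
  by (auto simp: sum_grading_def semidirect_mult_def add.commute[of b a]
      intro!: even_rules(1,3) subspace_rules)

lemma brAV_in: "p \<in> gradingAV a \<Longrightarrow> q \<in> gradingAV b \<Longrightarrow> brAV p q \<in> gradingAV (a + b)"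
  using even_rules(5)[of "fst p" a "snd q" b] even_rules(5)[of "fst q" b "snd p" a]
  by (simp add: brAV_eq)
    (auto simp: sum_grading_def add.commute[of b a] intro!: even_rules(2) subspace_rules)

lemma twistAV_in: "p \<in> gradingAV a \<Longrightarrow> twistAV p \<in> gradingAV a"
  by (auto simp: sum_grading_def intro: even_rules)

lemmas scale_rules = bimodule.mod.scale_right_distrib bimodule.mod.scale_right_diff_distrib
  alg.novikov.eps_add_left alg.novikov.eps_add_right
  alg.novikov.eps_swap alg.novikov.eps_swap_cancel

section \<open>The identities on homogeneous elements\<close>

context
  fixes a b c p q s x u y v z w
  assumes p: "p \<in> gradingAV a" "q \<in> gradingAV b" "s \<in> gradingAV c"
    and pq: "p = (x, u)" "q = (y, v)" "s = (z, w)"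
begin

lemma in_components: "x \<in> A a" "y \<in> A b" "z \<in> A c" "u \<in> V a" "v \<in> V b" "w \<in> V c"
  using p by (auto simp: sum_grading_def pq)

text \<open>The identity exchanges \<open>p\<close> and \<open>q\<close>. A module element in the
  third slot gives \<open>bimodule_1\<close>, in the second \<open>bimodule_2\<close>, in the first
  \<open>bimodule_3\<close>; each instance carries the same factor \<open>eps a b\<close>.\<close>

lemma left_symmetric_AV:
  "mulAV (mulAV p q) (twistAV s) - mulAV (twistAV p) (mulAV q s) =
    scaleAV (eps a b) (mulAV (mulAV q p) (twistAV s) - mulAV (twistAV q) (mulAV p s))"
  using alg.novikov.left_symmetric[OF in_components(1,2,3)]
    add_eqs[OF bimodule.bimodule_1[OF in_components(1,2,6)]
      bimodule.bimodule_2[OF in_components(1,3,5)] bimodule.bimodule_3[OF in_components(2,3,4)]]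
  by (simp add: pq semidirect_mult_def scaleAV_eq linear_rules diff_rules scale_rules algebra_simps)

text \<open>Here \<open>q\<close> and \<open>s\<close> are exchanged: the terms in \<open>w\<close>,
  \<open>v\<close> and \<open>u\<close> are governed by \<open>bimodule_4\<close>,
  \<open>bimodule_5\<close> and \<open>bimodule_6\<close>, each with factor
  \<open>eps b c\<close>.\<close>

lemma right_commutative_AV:
  "mulAV (mulAV p q) (twistAV s) = scaleAV (eps b c) (mulAV (mulAV p s) (twistAV q))"
  using alg.novikov.right_commutative[OF in_components(1,2,3)]
    add_eqs[OF bimodule.bimodule_4[OF in_components(1,2,6)]
      bimodule.bimodule_5[OF in_components(1,3,5)] bimodule.bimodule_6[OF in_components(2,3,4)]]
  by (simp add: pq semidirect_mult_def scaleAV_eq linear_rules diff_rules scale_rules algebra_simps)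

lemmas brAV_simps =
  brAV_eq[OF p(1,2)] brAV_eq[OF p(2,1)] brAV_eq[OF p(1,3)] brAV_eq[OF p(3,1)] brAV_eq[OF p(2,3)]

text \<open>In the \<open>V\<close>-coordinate, exchanging the arguments exchanges the two terms of
  the bracket, and \<open>eps_swap\<close> cancels the double factor.\<close>

lemma skew_symmetric_AV: "brAV p q = - scaleAV (eps a b) (brAV q p)"
  using alg.lie.skew_symmetric[OF in_components(1,2)]
  unfolding brAV_simps by (simp add: pq scaleAV_eq scale_rules)

text \<open>Each double bracket contains one term in which \<rho> is applied to a bracket of
  \<open>A\<close>. The representation axiom expands it, and then every composite of two actions
  occurs twice with opposite signs.\<close>

lemma jacobi_AV:
  "scaleAV (eps c a) (brAV (twistAV p) (brAV q s)) + scaleAV (eps a b) (brAV (twistAV q) (brAV s p))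
    + scaleAV (eps b c) (brAV (twistAV s) (brAV p q)) = 0"
  using alg.lie.jacobi[OF in_components(1,2,3)]
  \<comment> \<open>The outer brackets are expanded first, while the inner ones are intact and
    \<open>brAV_in\<close> still supplies their degrees.\<close>
  unfolding brAV_eq[OF twistAV_in[OF p(1)] brAV_in[OF p(2,3)]]
    brAV_eq[OF twistAV_in[OF p(2)] brAV_in[OF p(3,1)]]
    brAV_eq[OF twistAV_in[OF p(3)] brAV_in[OF p(1,2)]]
  unfolding brAV_simps
  by (simp add: pq scaleAV_eq linear_rules diff_rules scale_rules zero_prod_def algebra_simps
      lie_rep.representation[OF in_components(1,2,6)] lie_rep.representation[OF in_components(2,3,4)]
      lie_rep.representation[OF in_components(3,1,5)])

lemma gelfand_dorfman_AV:
  "mulAV (twistAV q) (brAV p s) =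
    scaleAV (eps b a) (brAV (twistAV p) (mulAV q s)) - scaleAV (eps (a + b) c) (brAV (twistAV s) (mulAV q p))
    + mulAV (brAV q p) (twistAV s) - scaleAV (eps a c) (mulAV (brAV q s) (twistAV p))"
  using alg.gelfand_dorfman[OF in_components(1,2,3)]
    add_eqs[OF compatible_left[OF in_components(1,2,6)] compatible_right[OF in_components(1,3,5)]
      \<comment> \<open>The bracket of \<open>p\<close> and \<open>s\<close> contributes the term
        \<open>- eps a c *\<^sub>V \<rho> z u\<close>. The terms in \<open>u\<close> therefore form
        the left compatibility for \<open>z\<close> and \<open>y\<close>, multiplied by
        \<open>- eps a c\<close>.\<close>
      arg_cong[OF compatible_left[OF in_components(3,2,4)], of "\<lambda>t. - (eps a c *\<^sub>V t)"]]
  unfolding brAV_eq[OF twistAV_in[OF p(1)] mulAV_in[OF p(2,3)]]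
    brAV_eq[OF twistAV_in[OF p(3)] mulAV_in[OF p(2,1)]]
  unfolding brAV_simps
  by (simp add: pq semidirect_mult_def scaleAV_eq linear_rules diff_rules scale_rules algebra_simps)

end

lemma semidirect_product: "hom_gelfand_dorfman scaleAV gradingAV mulAV brAV eps twistAV"
proof unfold_locales
  show "bilinear_map scaleAV scaleAV scaleAV mulAV" "bilinear_map scaleAV scaleAV scaleAV brAV"
    by (fact bilinear_mulAV bilinear_brAV)+
  \<comment> \<open>Linearity of the twist, being a locale itself, has been split into additivity
    and homogeneity.\<close>
  show "twistAV (p + q) = twistAV p + twistAV q" "twistAV (scaleAV t p) = scaleAV t (twistAV p)" for t p q
    by (cases p, cases q, simp add: scaleAV_eq linear_rules)+
  show "even_bimap gradingAV gradingAV gradingAV mulAV" "even_bimap gradingAV gradingAV gradingAV brAV"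
    "even_map gradingAV gradingAV twistAV"
    unfolding even_bimap_def even_map_def by (blast intro: mulAV_in brAV_in twistAV_in)+
  fix a b c p q s
  assume p: "p \<in> gradingAV a" "q \<in> gradingAV b"
  note pq = surjective_pairing[of p] surjective_pairing[of q]
  show "brAV p q = - scaleAV (eps a b) (brAV q p)"
    \<comment> \<open>Skew symmetry concerns two elements; \<open>q\<close> is used again as the
      third element that the context fixes.\<close>
    by (rule skew_symmetric_AV[OF p p(2) pq pq(2)])
  assume s: "s \<in> gradingAV c"
  note pqs = p s pq surjective_pairing[of s]
  show "mulAV (mulAV p q) (twistAV s) - mulAV (twistAV p) (mulAV q s) =
      scaleAV (eps a b) (mulAV (mulAV q p) (twistAV s) - mulAV (twistAV q) (mulAV p s))"
    by (rule left_symmetric_AV[OF pqs])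
  show "mulAV (mulAV p q) (twistAV s) = scaleAV (eps b c) (mulAV (mulAV p s) (twistAV q))"
    by (rule right_commutative_AV[OF pqs])
  show "scaleAV (eps c a) (brAV (twistAV p) (brAV q s)) + scaleAV (eps a b) (brAV (twistAV q) (brAV s p))
      + scaleAV (eps b c) (brAV (twistAV s) (brAV p q)) = 0"
    by (rule jacobi_AV[OF pqs])
  show "mulAV (twistAV q) (brAV p s) =
      scaleAV (eps b a) (brAV (twistAV p) (mulAV q s))
      - scaleAV (eps (a + b) c) (brAV (twistAV s) (mulAV q p))
      + mulAV (brAV q p) (twistAV s) - scaleAV (eps a c) (mulAV (brAV q s) (twistAV p))"
    by (rule gelfand_dorfman_AV[OF pqs])
qed

end

theorem proposition4p13:
  fixes scaleA :: "'k::{alg_closed_field, field_char_0} \<Rightarrow> 'a::ab_group_add \<Rightarrow> 'a"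
    and A :: "'g::ab_group_add \<Rightarrow> 'a set"
    and mul br :: "'a \<Rightarrow> 'a \<Rightarrow> 'a"
    and eps :: "'g \<Rightarrow> 'g \<Rightarrow> 'k"
    and \<alpha> :: "'a \<Rightarrow> 'a"
    and scaleV :: "'k \<Rightarrow> 'v::ab_group_add \<Rightarrow> 'v"
    and V :: "'g \<Rightarrow> 'v set"
    and l r \<rho> :: "'a \<Rightarrow> 'v \<Rightarrow> 'v"
    and \<beta> :: "'v \<Rightarrow> 'v"
  assumes "hom_gelfand_dorfman scaleA A mul br eps \<alpha>"
    and "hom_gelfand_dorfman_representation scaleA A mul br eps \<alpha> l r \<rho> \<beta> scaleV V"
  shows "hom_gelfand_dorfman (module_prod.scale scaleA scaleV) (sum_grading A V)
    (semidirect_mult mul l r) (semidirect_bracket A br eps \<rho> scaleV V) eps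
    (map_prod \<alpha> \<beta>)"
  using assms(2) by (rule hom_gelfand_dorfman_representation.semidirect_product)

end
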